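(* Let $H$ be a $3$-graph with at most two tight components which is not iterated tripartite. Then there exist constants $c>0$ and $n_0$ such that $r(H, K_n^{(3)}) \ge 2^{c \log^2 n}$ for all $n \ge n_0$.
   Context: A $3$-graph is a $3$-uniform hypergraph; $K_N^{(3)}$ is the complete $3$-graph on $N$ vertices. The Ramsey number $r(H, K_n^{(3)})$ is the smallest $N$ such that every red/blue-coloring of the edges of $K_N^{(3)}$ contains either a red copy of $H$ or a blue copy of $K_n^{(3)}$. A $3$-graph is tightly connected if for any two edges $e,f$ there is a sequence of edges $e=e_0,\dots,e_t=f$ with $e_{i-1}$ and $e_i$ sharing two vertices for each $i$. A tight component of $H$ is a maximal tightly connected subgraph of $H$ (the edge set of $H$ decomposes into disjoint tight components). A blowup of an edge is a complete tripartite $3$-graph (vertex set partitioned into three parts, edges are all triples with one vertex in each part). An iterated blowup of an edge is either a blowup of an edge or a $3$-graph formed by placing an iterated blowup of an edge inside one or more of the parts of a blowup of an edge (iteratively). A $3$-graph is iterated tripartite if it is a subgraph of an iterated blowup of an edge. *)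

theory Defs
  imports Complex_Main "HOL-Library.Ramsey"
begin

type_synonym 'a hypergraph = "'a set \<times> 'a set set"

abbreviation verts :: "'a hypergraph \<Rightarrow> 'a set" where
  "verts H \<equiv> fst H"

abbreviation edges :: "'a hypergraph \<Rightarrow> 'a set set" where
  "edges H \<equiv> snd H"

definition three_graph :: "'a hypergraph \<Rightarrow> bool" where
  "three_graph H \<longleftrightarrow> finite (verts H) \<and> edges H \<subseteq> nsets (verts H) 3"

definition complete3 :: "nat \<Rightarrow> nat hypergraph" where
  "complete3 N = ({..<N}, nsets {..<N} 3)"

text \<open>A copy of \<open>H\<close> in \<open>G\<close> is a not necessarily induced subgraph of \<open>G\<close> isomorphic to \<open>H\<close>.\<close>

definition contains_copy :: "'b hypergraph \<Rightarrow> 'a hypergraph \<Rightarrow> bool" where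
  "contains_copy G H \<longleftrightarrow>
     (\<exists>f. inj_on f (verts H) \<and> f ` verts H \<subseteq> verts G \<and> (\<forall>e\<in>edges H. f ` e \<in> edges G))"


datatype colour = Red | Blue

definition colour_class :: "'a hypergraph \<Rightarrow> ('a set \<Rightarrow> colour) \<Rightarrow> colour \<Rightarrow> 'a hypergraph" where
  "colour_class G \<chi> k = (verts G, {e \<in> edges G. \<chi> e = k})"

text \<open>For 3-graphs \<open>H\<close> and \<open>K\<close> the set of admissible \<open>N\<close> is nonempty by Ramsey's theorem, so
  \<open>LEAST\<close> is meaningful.\<close>

definition ramsey_number :: "'a hypergraph \<Rightarrow> 'b hypergraph \<Rightarrow> nat" where
  "ramsey_number H K =
     (LEAST N. \<forall>\<chi>. contains_copy (colour_class (complete3 N) \<chi> Red) H \<or>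
                   contains_copy (colour_class (complete3 N) \<chi> Blue) K)"


definition tight_walk :: "'a set set \<Rightarrow> 'a set list \<Rightarrow> bool" where
  "tight_walk F es \<longleftrightarrow> set es \<subseteq> F \<and> successively (\<lambda>e f. card (e \<inter> f) = 2) es"

definition tightly_connected :: "'a set set \<Rightarrow> bool" where
  "tightly_connected F \<longleftrightarrow>
     (\<forall>e\<in>F. \<forall>f\<in>F. \<exists>es. es \<noteq> [] \<and> hd es = e \<and> last es = f \<and> tight_walk F es)"

text \<open>A tight component is represented by its edge set. It is required to be nonempty, so that an
  edgeless 3-graph has no tight components.\<close>

definition tight_components :: "'a hypergraph \<Rightarrow> 'a set set set" where
  "tight_components H =
     {F. F \<noteq> {} \<and> F \<subseteq> edges H \<and> tightly_connected F \<and>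
         (\<forall>F'. F \<subseteq> F' \<and> F' \<subseteq> edges H \<and> tightly_connected F' \<longrightarrow> F' = F)}"


definition tripartite_edges :: "'a set \<Rightarrow> 'a set \<Rightarrow> 'a set \<Rightarrow> 'a set set" where
  "tripartite_edges A B C = {{a, b, c} | a b c. a \<in> A \<and> b \<in> B \<and> c \<in> C}"

text \<open>Each part either stays edgeless or carries an iterated blowup of an edge on its vertices; a
  plain blowup of an edge is the case where all three parts stay edgeless.\<close>

inductive iterated_blowup :: "'a set \<Rightarrow> 'a set set \<Rightarrow> bool" where
  "iterated_blowup (A \<union> B \<union> C) (tripartite_edges A B C \<union> EA \<union> EB \<union> EC)"
  if "finite A" "finite B" "finite C" "A \<noteq> {}" "B \<noteq> {}" "C \<noteq> {}"
    and "A \<inter> B = {}" "A \<inter> C = {}" "B \<inter> C = {}"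
    and "EA = {} \<or> iterated_blowup A EA"
    and "EB = {} \<or> iterated_blowup B EB"
    and "EC = {} \<or> iterated_blowup C EC"

text \<open>The ambient iterated blowup lives on natural numbers, so that its size is not limited by the
  vertex type of \<open>H\<close>.\<close>

definition iterated_tripartite :: "'a hypergraph \<Rightarrow> bool" where
  "iterated_tripartite H \<longleftrightarrow>
     (\<exists>V E. iterated_blowup V E \<and> contains_copy ((V, E) :: nat hypergraph) H)"

end

theory Submission
  imports Defs "HOL-Library.Disjoint_Sets"
begin

text \<open>
  Place \<open>r ^ k\<close> vertices at the leaves of the \<open>r\<close>-ary tree of depth \<open>k\<close>, where \<open>r = 2 ^ k\<close>. Two leaves that separate at
  a node, into children \<open>a\<close> and \<open>b\<close>, choose at random a third child \<open>\<phi>\<close> of that node. A triple is red if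
  it separates at one node into three different children and each pair has chosen the child of the
  third vertex. A pair thus determines the node and the three children of every red triple through
  it, so a red tight component lives below three children of one node. Given two such components,
  either their triples of children share two children of the same node, and then their union is
  tripartite, or the vertices of one component all lie in one part of a tripartition of the other.
  So a red copy of a 3-graph with at most two tight components makes it iterated tripartite.

  With high probability any three sets of size \<open>s = 2 ^ (5 * k)\<close> below different children of a node span
  a red triple. A set without red triples therefore has at least \<open>s\<close> vertices below at most two
  children of each node, which bounds its size by \<open>2 ^ k * (1 + r * s) < 2 ^ (8 * k)\<close>, while there
  are \<open>2 ^ (k\<^sup>2)\<close> vertices.
\<close>

section \<open>Two-level tripartitions as iterated blowups\<close>

text \<open>A blowup of depth two suffices as host: \<open>g\<close> is the outer tripartition and
  \<open>g'\<close> splits its part 0 once more. Values other than 0 and 1 go to the last part of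
  their level.\<close>

lemma iterated_tripartiteI:
  fixes H :: "'a hypergraph" and g g' :: "'a \<Rightarrow> nat"
  assumes H: "three_graph H"
    and edges: "\<And>e. e \<in> edges H \<Longrightarrow> g ` e = {0,1,2} \<or> g ` e = {0} \<and> g' ` e = {0,1,2}"
  shows "iterated_tripartite H"
proof -
  have fin: "finite (verts H)" and sub: "edges H \<subseteq> nsets (verts H) 3"
    using H by (auto simp: three_graph_def)
  obtain i m where i: "bij_betw i (verts H) {..<m::nat}"
    using ex_bij_betw_finite_nat[OF fin] by (auto simp: atLeast0LessThan)
  define part where "part P = i ` {x \<in> verts H. P x}" for P
  have finpart: "finite (part P)" for P using fin by (simp add: part_def)
  have less: "y < m" if "y \<in> part P" for y P
    using that i by (auto simp: part_def bij_betw_def)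
  have disj: "part P \<inter> part Q = {}" if "\<And>x. \<not> (P x \<and> Q x)" for P Q
    using that i by (auto simp: part_def bij_betw_def inj_on_def)
  have fresh: "m \<notin> part P" "Suc m \<notin> part P" "Suc (Suc m) \<notin> part P" "m + t \<notin> part P" for P t
    using less[of m P] less[of "Suc m" P] less[of "Suc (Suc m)" P] less[of "m + t" P] by auto
  \<comment> \<open>The dummy vertices \<open>m\<close>, ..., \<open>m+4\<close> lie outside the
    image of \<open>i\<close> and keep every part nonempty, as \<open>iterated_blowup\<close>
    demands.\<close>
  define A0 where "A0 = insert m (part (\<lambda>x. g x = 0 \<and> g' x = 0))"
  define A1 where "A1 = insert (m+1) (part (\<lambda>x. g x = 0 \<and> g' x = 1))"
  define A2 where "A2 = insert (m+2) (part (\<lambda>x. g x = 0 \<and> g' x \<noteq> 0 \<and> g' x \<noteq> 1))"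
  define B where "B = insert (m+3) (part (\<lambda>x. g x = 1))"
  define C where "C = insert (m+4) (part (\<lambda>x. g x \<noteq> 0 \<and> g x \<noteq> 1))"
  note defs = A0_def A1_def A2_def B_def C_def
  have dj: "A0 \<inter> A1 = {}" "A0 \<inter> A2 = {}" "A1 \<inter> A2 = {}"
    "A0 \<inter> B = {}" "A1 \<inter> B = {}" "A2 \<inter> B = {}" "A0 \<inter> C = {}" "A1 \<inter> C = {}" "A2 \<inter> C = {}" "B \<inter> C = {}"
    unfolding defs by (simp_all add: fresh) (intro conjI disj; auto)+
  define EA where "EA = tripartite_edges A0 A1 A2"
  have "iterated_blowup (A0 \<union> A1 \<union> A2) (tripartite_edges A0 A1 A2 \<union> {} \<union> {} \<union> {})"
    by (rule iterated_blowup.intros) (use dj finpart in \<open>auto simp: defs\<close>)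
  then have ibA: "iterated_blowup (A0 \<union> A1 \<union> A2) EA" by (simp add: EA_def)
  let ?V = "A0 \<union> A1 \<union> A2 \<union> B \<union> C"
  let ?E = "tripartite_edges (A0 \<union> A1 \<union> A2) B C \<union> EA \<union> {} \<union> {}"
  have ib: "iterated_blowup ?V ?E"
  proof (rule iterated_blowup.intros)
    show "EA = {} \<or> iterated_blowup (A0 \<union> A1 \<union> A2) EA" using ibA by blast
  qed (use dj finpart in \<open>auto simp: defs\<close>)
  have "contains_copy (?V, ?E) H"
    unfolding contains_copy_def
  proof (intro exI conjI ballI)
    show "inj_on i (verts H)" using i by (simp add: bij_betw_def)
    show "i ` verts H \<subseteq> verts (?V, ?E)"
    proof clarify
      fix x assume "x \<in> verts H"
      then have "i x \<in> part P" if "P x" for P using that by (simp add: part_def)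
      then show "i x \<in> verts (?V, ?E)"
        by (cases "g x = 0"; cases "g x = 1"; cases "g' x = 0"; cases "g' x = 1") (simp_all add: defs)
    qed
    fix e assume e: "e \<in> edges H"
    then have e3: "e \<subseteq> verts H" "card e = 3" "finite e"
      using sub by (auto simp: nsets_def)
    have split: "\<exists>x y z. e = {x,y,z} \<and> k x = 0 \<and> k y = 1 \<and> k z = 2" if "k ` e = {0,1,2}" for k :: "'a \<Rightarrow> nat"
    proof -
      have "0 \<in> k ` e" "1 \<in> k ` e" "2 \<in> k ` e" using that by simp_all
      then obtain x y z where xyz: "x \<in> e" "y \<in> e" "z \<in> e" "k x = 0" "k y = 1" "k z = 2"
        unfolding image_iff by metis
      then have "x \<noteq> y" "x \<noteq> z" "y \<noteq> z" by auto
      then have "card {x,y,z} = 3" by simp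
      then have "{x,y,z} = e" using xyz e3 by (intro card_subset_eq) auto
      with xyz show ?thesis by blast
    qed
    from edges[OF e] show "i ` e \<in> edges (?V, ?E)"
    proof
      assume "g ` e = {0,1,2}"
      from split[OF this] obtain x y z where xyz: "e = {x,y,z}" "g x = 0" "g y = 1" "g z = 2" by blast
      then have "i x \<in> A0 \<union> A1 \<union> A2" "i y \<in> B" "i z \<in> C"
        using e3 by (auto simp: defs part_def)
      then have "i ` e \<in> tripartite_edges (A0 \<union> A1 \<union> A2) B C"
        unfolding tripartite_edges_def xyz(1) by auto
      then show ?thesis by simp
    next
      assume a: "g ` e = {0} \<and> g' ` e = {0,1,2}"
      from split[OF conjunct2[OF this]]
      obtain x y z where xyz: "e = {x,y,z}" "g' x = 0" "g' y = 1" "g' z = 2" by blast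
      then have "i x \<in> A0" "i y \<in> A1" "i z \<in> A2"
        using e3 a by (auto simp: defs part_def)
      then have "i ` e \<in> EA"
        unfolding EA_def tripartite_edges_def xyz(1) by auto
      then show ?thesis by simp
    qed
  qed
  with ib show ?thesis unfolding iterated_tripartite_def by blast
qed

section \<open>Tight components and their invariants\<close>

lemma tight_component_exists:
  assumes "finite (edges H)" "e \<in> edges H"
  shows "\<exists>F \<in> tight_components H. e \<in> F"
proof -
  define X where "X = {F. e \<in> F \<and> F \<subseteq> edges H \<and> tightly_connected F}"
  have "tightly_connected {e}"
    unfolding tightly_connected_def tight_walk_def by (auto intro!: exI[of _ "[e]"])
  then have "{e} \<in> X" using assms(2) by (simp add: X_def)
  moreover have "finite X" using assms(1) by (auto simp: X_def intro: finite_subset[OF _ finite_Pow_iff[THEN iffD2]])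
  ultimately obtain F where F: "F \<in> X" "\<And>F'. F' \<in> X \<Longrightarrow> F \<subseteq> F' \<Longrightarrow> F = F'"
    using finite_has_maximal[of X] by blast
  then have "F \<in> tight_components H" "e \<in> F"
    by (auto simp: tight_components_def X_def)
  then show ?thesis by blast
qed

lemma tight_walk_invariant:
  assumes "\<And>e e'. e \<in> F \<Longrightarrow> e' \<in> F \<Longrightarrow> card (e \<inter> e') = 2 \<Longrightarrow> l e = l e'"
    and "tight_walk F es" "es \<noteq> []"
  shows "l (hd es) = l (last es)"
  using assms(2,3)
proof (induction es)
  case (Cons e es)
  show ?case
  proof (cases es)
    case (Cons e' es')
    then have "tight_walk F es" "l e = l e'"
      using Cons.prems(1) assms(1) by (auto simp: tight_walk_def)
    then show ?thesis using Cons.IH Cons by simp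
  qed simp
qed simp

text \<open>Such an \<open>l\<close> is constant along tight walks, hence on each tight component.
  Every edge lies in some component, so one representative per component yields all values.
  Finiteness matters, since \<open>card\<close> of an infinite set of components would be 0.\<close>

lemma card_invariant_le_tight_components:
  assumes "finite (edges H)"
    and "\<And>e e'. e \<in> edges H \<Longrightarrow> e' \<in> edges H \<Longrightarrow> card (e \<inter> e') = 2 \<Longrightarrow> l e = l e'"
  shows "card (l ` edges H) \<le> card (tight_components H)"
proof -
  have const: "l e = l e'" if F: "F \<in> tight_components H" and ee': "e \<in> F" "e' \<in> F" for F e e'
  proof -
    have FE: "F \<subseteq> edges H" and "tightly_connected F" using F by (auto simp: tight_components_def)
    then obtain es where "es \<noteq> []" "hd es = e" "last es = e'" "tight_walk F es"
      using ee' unfolding tightly_connected_def by blast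
    then show ?thesis using tight_walk_invariant[of F l es] assms(2) FE by blast
  qed
  have "finite (tight_components H)"
    using assms(1) by (auto simp: tight_components_def intro: finite_subset[OF _ finite_Pow_iff[THEN iffD2]])
  moreover have "l ` edges H \<subseteq> (\<lambda>F. l (SOME e. e \<in> F)) ` tight_components H"
  proof clarify
    fix e assume "e \<in> edges H"
    then obtain F where F: "F \<in> tight_components H" "e \<in> F"
      using tight_component_exists[OF assms(1)] by blast
    then have "l e = l (SOME e. e \<in> F)" using const someI[of "\<lambda>e. e \<in> F" e] by blast
    with F show "l e \<in> (\<lambda>F. l (SOME e. e \<in> F)) ` tight_components H" by blast
  qed
  ultimately show ?thesis by (meson card_image_le card_mono finite_imageI le_trans)
qed

section \<open>Red triples in the tree and their tight components\<close>

text \<open>The vertex \<open>x\<close> lies below the node \<open>x div r ^ j\<close> of height \<open>j\<close>, which is child number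
  \<open>(x div r ^ j) mod r\<close> of its parent.\<close>

definition level_edge :: "nat \<Rightarrow> (nat set \<Rightarrow> nat) \<Rightarrow> nat \<Rightarrow> nat set \<Rightarrow> bool" where
  "level_edge r \<phi> j e \<longleftrightarrow> card ((\<lambda>x. x div r ^ j) ` e) = 3 \<and>
     (\<forall>x\<in>e. \<forall>y\<in>e. x div r ^ Suc j = y div r ^ Suc j) \<and>
     (\<forall>x\<in>e. \<forall>y\<in>e. \<forall>z\<in>e. x \<noteq> y \<and> x \<noteq> z \<and> y \<noteq> z \<longrightarrow> \<phi> {x,y} = (z div r ^ j) mod r)"

lemma div_power_coarsen:
  fixes x y r :: nat
  assumes "x div r ^ i = y div r ^ i" "i \<le> j"
  shows "x div r ^ j = y div r ^ j"
proof -
  have "r ^ j = r ^ i * r ^ (j - i)" using assms(2) by (simp flip: power_add)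
  then show ?thesis using assms(1) by (simp add: div_mult2_eq)
qed

lemma level_edgeD:
  assumes "level_edge r \<phi> j e"
  shows "card ((\<lambda>x. x div r ^ j) ` e) = 3"
    and "x \<in> e \<Longrightarrow> y \<in> e \<Longrightarrow> x div r ^ Suc j = y div r ^ Suc j"
    and "x \<in> e \<Longrightarrow> y \<in> e \<Longrightarrow> z \<in> e \<Longrightarrow> x \<noteq> y \<Longrightarrow> x \<noteq> z \<Longrightarrow> y \<noteq> z \<Longrightarrow> (z div r ^ j) mod r = \<phi> {x,y}"
proof -
  have card: "card ((\<lambda>x. x div r ^ j) ` e) = 3"
    and parent: "\<forall>x\<in>e. \<forall>y\<in>e. x div r ^ Suc j = y div r ^ Suc j"
    and third: "\<forall>x\<in>e. \<forall>y\<in>e. \<forall>z\<in>e. x \<noteq> y \<and> x \<noteq> z \<and> y \<noteq> z \<longrightarrow> \<phi> {x,y} = (z div r ^ j) mod r"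
    using assms unfolding level_edge_def by blast+
  show "card ((\<lambda>x. x div r ^ j) ` e) = 3" by (fact card)
  show "x \<in> e \<Longrightarrow> y \<in> e \<Longrightarrow> x div r ^ Suc j = y div r ^ Suc j" using parent by blast
  show "x \<in> e \<Longrightarrow> y \<in> e \<Longrightarrow> z \<in> e \<Longrightarrow> x \<noteq> y \<Longrightarrow> x \<noteq> z \<Longrightarrow> y \<noteq> z \<Longrightarrow> (z div r ^ j) mod r = \<phi> {x,y}"
    using third by simp
qed

text \<open>The common pair separates at one node only, which fixes the height and the parent. Both
  third vertices then lie below the child that \<open>\<phi>\<close> assigns to this pair. So the
  height together with the three children is an invariant of tight components of red
  triples.\<close>

lemma level_edge_tight:
  assumes e: "level_edge r \<phi> j e" "card e = 3" and e': "level_edge r \<phi> j' e'" "card e' = 3"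
    and two: "card (e \<inter> e') = 2"
  shows "j = j' \<and> (\<lambda>x. x div r ^ j) ` e = (\<lambda>x. x div r ^ j') ` e'"
proof -
  have fin: "finite e" "finite e'" using e(2) e'(2) by (simp_all add: card_ge_0_finite)
  obtain x y where xy: "e \<inter> e' = {x,y}" "x \<noteq> y" using two by (auto simp: card_2_iff)
  have "card (e - (e \<inter> e')) = 1" using card_Diff_subset_Int[of e "e \<inter> e'"] fin e(2) two by simp
  then obtain z where "e - (e \<inter> e') = {z}" by (auto simp: card_1_singleton_iff)
  then have z: "e = {x,y,z}" "z \<noteq> x" "z \<noteq> y" using xy by auto
  have "card (e' - (e \<inter> e')) = 1" using card_Diff_subset_Int[of e' "e \<inter> e'"] fin e'(2) two by (simp add: Int_commute Int_left_commute)
  then obtain z' where "e' - (e \<inter> e') = {z'}" by (auto simp: card_1_singleton_iff)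
  then have z': "e' = {x,y,z'}" "z' \<noteq> x" "z' \<noteq> y" using xy by auto
  have inj: "inj_on (\<lambda>x. x div r ^ j) e" using level_edgeD(1)[OF e(1)] e(2) fin by (simp add: eq_card_imp_inj_on)
  have inj': "inj_on (\<lambda>x. x div r ^ j') e'" using level_edgeD(1)[OF e'(1)] e'(2) fin by (simp add: eq_card_imp_inj_on)
  have ne: "x div r ^ j \<noteq> y div r ^ j" using inj z xy by (auto simp: inj_on_def)
  have ne': "x div r ^ j' \<noteq> y div r ^ j'" using inj' z' xy by (auto simp: inj_on_def)
  have eq: "x div r ^ Suc j = y div r ^ Suc j" "x div r ^ Suc j = z div r ^ Suc j" by (rule level_edgeD(2)[OF e(1)]; simp add: z)+
  have eq': "x div r ^ Suc j' = y div r ^ Suc j'" "x div r ^ Suc j' = z' div r ^ Suc j'" by (rule level_edgeD(2)[OF e'(1)]; simp add: z')+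
  have jj: "j = j'"
  proof (rule ccontr)
    assume "j \<noteq> j'"
    then have "Suc j \<le> j' \<or> Suc j' \<le> j" by linarith
    then show False
      using div_power_coarsen[OF eq(1), of j'] div_power_coarsen[OF eq'(1), of j] ne ne' by blast
  qed
  have "(z div r ^ j) mod r = \<phi> {x,y}" by (rule level_edgeD(3)[OF e(1)]) (use z xy in auto)
  moreover have "(z' div r ^ j') mod r = \<phi> {x,y}" by (rule level_edgeD(3)[OF e'(1)]) (use z' xy in auto)
  \<comment> \<open>\<open>mod r\<close> gives the number among siblings and \<open>div r\<close>
    the parent; together they determine the node.\<close>
  ultimately have "(z div r ^ j) mod r = (z' div r ^ j) mod r" using jj by simp
  moreover have "(z div r ^ j) div r = (z' div r ^ j) div r"
    using eq(2) eq'(2) jj by (simp add: div_mult2_eq[symmetric] mult.commute)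
  ultimately have "z div r ^ j = z' div r ^ j" by (metis div_mult_mod_eq)
  then show ?thesis using jj z z' by simp
qed


text \<open>By \<open>level_edge_tight\<close> each tight component has a single label, a height
  with three nodes of that height, so at most two labels occur. Each configuration of two labels
  reduces to an outer tripartition and possibly an inner one.\<close>

lemma iterated_tripartite_if_embeds:
  fixes H :: "'a hypergraph"
  assumes H: "three_graph H" and tc: "card (tight_components H) \<le> 2"
    and f: "inj_on f (verts H)"
    and red: "\<And>e. e \<in> edges H \<Longrightarrow> \<exists>j. level_edge r \<phi> j (f ` e)"
  shows "iterated_tripartite H"
proof (cases "edges H = {}")
  case True
  show ?thesis by (rule iterated_tripartiteI[OF H, where g = "\<lambda>_. 0" and g' = "\<lambda>_. 0"]) (simp add: True)
next
  case False
  have sub: "edges H \<subseteq> nsets (verts H) 3" and finE: "finite (edges H)"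
    using H by (auto simp: three_graph_def intro: finite_subset finite_imp_finite_nsets)
  define J where "J e = (SOME j. level_edge r \<phi> j (f ` e))" for e
  have J: "level_edge r \<phi> (J e) (f ` e)" if "e \<in> edges H" for e
    unfolding J_def using red[OF that] by (rule someI_ex)
  \<comment> \<open>The quotient is not reduced modulo \<open>r\<close>: it identifies the node
    among all nodes of height \<open>j\<close>, not only among its siblings.\<close>
  define child where "child j x = f x div r ^ j" for j x
  define l where "l e = (J e, child (J e) ` e)" for e
  have card_f: "card (f ` e) = card e" if "e \<subseteq> verts H" for e
    using f that by (meson card_image inj_on_subset)
  have verts: "e \<subseteq> verts H" "card e = 3" "e \<noteq> {}" if "e \<in> edges H" for e
    using sub that by (auto simp: nsets_def)
  have l_tight: "l e = l e'" if e: "e \<in> edges H" "e' \<in> edges H" "card (e \<inter> e') = 2" for e e'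
  proof -
    have "f ` e \<inter> f ` e' = f ` (e \<inter> e')"
      using inj_on_image_Int[OF f verts(1)[OF e(1)] verts(1)[OF e(2)]] by simp
    then have "card (f ` e \<inter> f ` e') = 2" using card_f[of "e \<inter> e'"] verts(1) e by auto
    then have "J e = J e' \<and> (\<lambda>x. x div r ^ J e) ` f ` e = (\<lambda>x. x div r ^ J e') ` f ` e'"
      using e(1,2) card_f verts by (intro level_edge_tight[OF J[OF e(1)] _ J[OF e(2)]]) auto
    moreover have "child j ` X = (\<lambda>x. x div r ^ j) ` f ` X" for j X by (auto simp: child_def)
    ultimately show ?thesis unfolding l_def prod.inject by metis
  qed
  have "card (l ` edges H) \<le> card (tight_components H)"
    by (rule card_invariant_le_tight_components[OF finE]) (rule l_tight)
  moreover have "card (l ` edges H) > 0" using False finE by (simp add: card_gt_0_iff)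
  ultimately have "card (l ` edges H) = 1 \<or> card (l ` edges H) = 2" using tc by linarith
  \<comment> \<open>A single label gives \<open>p = q\<close>, which falls under the case of two
    common nodes below.\<close>
  then obtain p q where pq: "l ` edges H = {p, q}"
    by (elim disjE card_1_singletonE) (auto simp: card_2_iff)
  have parts: "card T = 3 \<and> (\<forall>x\<in>e. \<forall>y\<in>e. f x div r ^ Suc i = f y div r ^ Suc i) \<and> child i ` e = T"
    if "e \<in> edges H" "l e = (i, T)" for e i T
    using level_edgeD(1,2)[OF J[OF that(1)]] that(2) by (auto simp: l_def child_def image_image)
  \<comment> \<open>Outer parts 1 and 2 are the vertices below \<open>b\<close> and
    \<open>c\<close>; part 0 is the rest. It contains all edges labelled \<open>(j, U)\<close>, and
    \<open>h'\<close> splits them by their nodes in \<open>U\<close>.\<close>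
  have split: ?thesis
    if labels: "l ` edges H = {(i, T), (j, U)}" and bc: "b \<in> T" "c \<in> T" "b \<noteq> c"
      and avoid: "\<And>e x. e \<in> edges H \<Longrightarrow> l e = (j, U) \<Longrightarrow> x \<in> e \<Longrightarrow> child i x \<notin> {b, c}"
    for i T j U b c
  proof -
    have "card T = 3" "card U = 3"
      using labels parts by (metis imageE insertI1, metis imageE insertI1 insertI2)
    then obtain u v w where U: "U = {u, v, w}" "u \<noteq> v" "u \<noteq> w" "v \<noteq> w" by (auto simp: card_3_iff)
    have "card (T - {b, c}) = 1" using \<open>card T = 3\<close> bc by (simp add: card_Diff_subset)
    then obtain a where "T - {b, c} = {a}" by (auto simp: card_1_singleton_iff)
    then have T: "T = {a, b, c}" "a \<noteq> b" "a \<noteq> c" using bc by auto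
    define h where "h t = (if t = b then 1 else if t = c then 2 else 0 :: nat)" for t
    define h' where "h' t = (if t = u then 0 else if t = v then 1 else 2 :: nat)" for t
    show ?thesis
    proof (rule iterated_tripartiteI[OF H, where g = "\<lambda>x. h (child i x)" and g' = "\<lambda>x. h' (child j x)"])
      fix e assume e: "e \<in> edges H"
      then have "l e = (i, T) \<or> l e = (j, U)" using labels by blast
      then show "(\<lambda>x. h (child i x)) ` e = {0,1,2} \<or>
        (\<lambda>x. h (child i x)) ` e = {0} \<and> (\<lambda>x. h' (child j x)) ` e = {0,1,2}"
      proof
        assume "l e = (i, T)"
        then have "(\<lambda>x. h (child i x)) ` e = h ` T" using parts[OF e] by (metis image_image)
        also have "\<dots> = {0,1,2}" using T bc by (auto simp: h_def)
        finally show ?thesis by blast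
      next
        assume le: "l e = (j, U)"
        then have "(\<lambda>x. h' (child j x)) ` e = h' ` U" using parts[OF e] by (metis image_image)
        also have "\<dots> = {0,1,2}" using U by (auto simp: h'_def)
        finally have "(\<lambda>x. h' (child j x)) ` e = {0,1,2}" .
        moreover have "h (child i x) = 0" if "x \<in> e" for x
          using avoid[OF e le that] by (simp add: h_def)
        then have "(\<lambda>x. h (child i x)) ` e = {0}" using verts(3)[OF e] by auto
        ultimately show ?thesis by blast
      qed
    qed
  qed
  have two: "\<exists>b c. b \<in> X \<and> c \<in> X \<and> b \<noteq> c" if "card X \<ge> 2" for X :: "nat set"
    using that by (metis One_nat_def card_le_Suc0_iff_eq card.infinite not_numeral_le_zero numeral_2_eq_2 not_less_eq_eq)
  \<comment> \<open>All edges labelled \<open>(j, U)\<close> lie below one node of height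
    \<open>Suc j \<le> i\<close>, hence below one node of height \<open>i\<close>. At least two
    nodes of \<open>T\<close> differ from it and serve as \<open>b\<close> and
    \<open>c\<close>.\<close>
  have coarser: ?thesis if labels: "l ` edges H = {(i, T), (j, U)}" and "j < i" for i T j U
  proof -
    obtain e0 where e0: "e0 \<in> edges H" "l e0 = (j, U)" using labels by (metis imageE insertI1 insertI2)
    obtain x0 where x0: "x0 \<in> e0" using verts(3)[OF e0(1)] by blast
    have "card T = 3" using labels parts by (metis imageE insertI1)
    then have "card (T - {child i x0}) \<ge> 2" by (simp add: card_Diff_singleton_if)
    then obtain b c where bc: "b \<in> T - {child i x0}" "c \<in> T - {child i x0}" "b \<noteq> c" using two by blast
    have "child i x = child i x0" if e: "e \<in> edges H" "l e = (j, U)" "x \<in> e" for e x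
    proof -
      have "child j x \<in> child j ` e0" using parts[OF e(1,2)] parts[OF e0] e(3) by blast
      then obtain y where y: "y \<in> e0" "child j x = child j y" by blast
      then have "child i x = child i y"
        using div_power_coarsen[of "f x" r j "f y" i] \<open>j < i\<close> by (simp add: child_def)
      also have "\<dots> = child i x0"
        unfolding child_def
      proof (rule div_power_coarsen)
        show "f y div r ^ Suc j = f x0 div r ^ Suc j" using parts[OF e0] y(1) x0 by blast
      qed (use \<open>j < i\<close> in simp)
      finally show ?thesis .
    qed
    then show ?thesis using bc by (intro split[OF labels, of b c]) auto
  qed
  obtain i T j U where pq': "p = (i, T)" "q = (j, U)" by (meson surj_pair)
  have labels: "l ` edges H = {(i, T), (j, U)}" "l ` edges H = {(j, U), (i, T)}" using pq pq' by auto
  consider "j < i" | "i < j" | "i = j" by linarith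
  then show ?thesis
  proof cases
    case 1
    then show ?thesis by (rule coarser[OF labels(1)])
  next
    case 2
    then show ?thesis by (rule coarser[OF labels(2)])
  next
    case 3
    have cards: "card T = 3" "card U = 3"
      using labels(1) parts by (metis imageE insertI1, metis imageE insertI1 insertI2)
    then have fin: "finite T" "finite U" by (auto intro: card_ge_0_finite)
    show ?thesis
    proof (cases "card (T \<inter> U) \<ge> 2")
      case True
      then obtain a b where ab: "a \<in> T \<inter> U" "b \<in> T \<inter> U" "a \<noteq> b" using two by blast
      \<comment> \<open>Every edge has nodes \<open>a\<close> and \<open>b\<close>; its third node,
        whichever it is, goes to part 2, so one tripartition serves both labels.\<close>
      define h where "h t = (if t = a then 0 else if t = b then 1 else 2 :: nat)" for t
      have h: "h ` X = {0,1,2}" if "card X = 3" "a \<in> X" "b \<in> X" for X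
      proof -
        have "card (X - {a, b}) = 1" using that ab(3) by (simp add: card_Diff_subset)
        then obtain c where "X - {a, b} = {c}" by (auto simp: card_1_singleton_iff)
        then have "X = {a, b, c}" "c \<noteq> a" "c \<noteq> b" using that by auto
        then show ?thesis using ab(3) by (auto simp: h_def)
      qed
      show ?thesis
      proof (rule iterated_tripartiteI[OF H, where g = "\<lambda>x. h (child i x)" and g' = "\<lambda>_. 0"])
        fix e assume e: "e \<in> edges H"
        then have "l e = (i, T) \<or> l e = (j, U)" using labels(1) by blast
        then have "child i ` e = T \<or> child i ` e = U" using parts[OF e] 3 by auto
        moreover have "h ` T = {0,1,2}" "h ` U = {0,1,2}" by (rule h; use cards ab in blast)+
        ultimately have "h ` child i ` e = {0,1,2}" by (elim disjE) simp_all
        then show "(\<lambda>x. h (child i x)) ` e = {0,1,2} \<or>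
          (\<lambda>x. h (child i x)) ` e = {0} \<and> (\<lambda>_. 0) ` e = {0,1,2::nat}" by (simp add: image_image)
      qed
    next
      case False
      then have "card (T - U) \<ge> 2" using cards fin by (simp add: card_Diff_subset_Int)
      then obtain b c where bc: "b \<in> T - U" "c \<in> T - U" "b \<noteq> c" using two by blast
      show ?thesis
      proof (rule split[OF labels(1), of b c])
        fix e x assume "e \<in> edges H" "l e = (j, U)" "x \<in> e"
        then have "child i x \<in> U" using parts 3 by blast
        then show "child i x \<notin> {b, c}" using bc by blast
      qed (use bc in auto)
    qed
  qed
qed

section \<open>Sets without red triples\<close>

lemma level_edgeI:
  assumes "x div r ^ Suc j = q" "y div r ^ Suc j = q" "z div r ^ Suc j = q"
    and "x div r ^ j \<noteq> y div r ^ j" "x div r ^ j \<noteq> z div r ^ j" "y div r ^ j \<noteq> z div r ^ j"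
    and "\<phi> {x,y} = (z div r ^ j) mod r" "\<phi> {x,z} = (y div r ^ j) mod r" "\<phi> {y,z} = (x div r ^ j) mod r"
  shows "level_edge r \<phi> j {x,y,z}"
proof -
  have "t div r ^ Suc j = q" if "t \<in> {x,y,z}" for t using that assms(1-3) by blast
  moreover have "\<phi> {t,u} = (v div r ^ j) mod r"
    if "t \<in> {x,y,z}" "u \<in> {x,y,z}" "v \<in> {x,y,z}" "t \<noteq> u \<and> t \<noteq> v \<and> u \<noteq> v" for t u v
  proof -
    from that have "{t,u} = {x,y} \<and> v = z \<or> {t,u} = {x,z} \<and> v = y \<or> {t,u} = {y,z} \<and> v = x" by auto
    then show ?thesis using assms(7-9) by (elim disjE conjE) simp_all
  qed
  moreover have "card ((\<lambda>t. t div r ^ j) ` {x,y,z}) = 3" using assms(4-6) by simp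
  ultimately show ?thesis unfolding level_edge_def by metis
qed

text \<open>Induct on the height \<open>K\<close> of a node above all of \<open>S\<close>. Three
  children with \<open>s\<close> vertices each would yield a red triple by the property of
  \<open>\<phi>\<close>, so at most two children are large. If \<open>B\<close> bounds the size
  below each child, then \<open>2 * B + r * s\<close> bounds it below the node; adding
  \<open>r * s\<close> turns this into a doubling per level, whence the form of the bound.\<close>

lemma card_independent_le:
  fixes r s K :: nat
  assumes r: "r > 0"
    and \<phi>: "\<And>X Y Z a b c. \<lbrakk>X \<subseteq> {..<M}; Y \<subseteq> {..<M}; Z \<subseteq> {..<M}; card X = s; card Y = s; card Z = s;
       X \<inter> Y = {}; X \<inter> Z = {}; Y \<inter> Z = {}; a < r; b < r; c < r\<rbrakk> \<Longrightarrow>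
       \<exists>x\<in>X. \<exists>y\<in>Y. \<exists>z\<in>Z. \<phi> {x,y} = c \<and> \<phi> {x,z} = b \<and> \<phi> {y,z} = a"
    and "S \<subseteq> {..<M}" "\<And>e j. e \<subseteq> S \<Longrightarrow> card e = 3 \<Longrightarrow> \<not> level_edge r \<phi> j e"
    and "\<And>x. x \<in> S \<Longrightarrow> x div r ^ K = q"
  shows "card S + r * s \<le> 2 ^ K * (1 + r * s)"
  using assms(3-)
proof (induction K arbitrary: S q)
  case 0
  then have "S \<subseteq> {q}" by auto
  then have "card S \<le> 1" using card_mono[of "{q}" S] by simp
  then show ?case by simp
next
  case (Suc j)
  define P where "P c = {x \<in> S. (x div r ^ j) mod r = c}" for c
  have div_eq: "x div r ^ j = q * r + c" if "x \<in> P c" for x c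
  proof -
    have "(x div r ^ j) div r = q"
      using that Suc.prems(3)[of x] by (simp add: P_def div_mult2_eq mult.commute flip: div_mult2_eq)
    then show ?thesis using that div_mult_mod_eq[of "x div r ^ j" r] by (simp add: P_def)
  qed
  have bound: "card (P c) + r * s \<le> 2 ^ j * (1 + r * s)" for c
  proof (rule Suc.IH)
    show "P c \<subseteq> {..<M}" using Suc.prems(1) by (auto simp: P_def)
    show "\<not> level_edge r \<phi> i e" if "e \<subseteq> P c" "card e = 3" for e i
      using that by (intro Suc.prems(2)) (auto simp: P_def)
  qed (rule div_eq)
  define Big where "Big = {c. c < r \<and> s \<le> card (P c)}"
  have finB: "finite Big" by (simp add: Big_def)
  have Big: "card Big \<le> 2"
  proof (rule ccontr)
    assume "\<not> card Big \<le> 2"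
    then obtain C where "C \<subseteq> Big" "card C = 3" using obtain_subset_with_card_n[of 3 Big] by auto
    then obtain a b c where abc: "a \<in> Big" "b \<in> Big" "c \<in> Big" "a \<noteq> b" "a \<noteq> c" "b \<noteq> c"
      by (auto simp: card_3_iff)
    have big: "\<exists>X. X \<subseteq> P c \<and> card X = s" if "c \<in> Big" for c
      using that obtain_subset_with_card_n[of s "P c"] by (auto simp: Big_def)
    obtain X Y Z where X: "X \<subseteq> P a" "card X = s" and Y: "Y \<subseteq> P b" "card Y = s" and Z: "Z \<subseteq> P c" "card Z = s"
      using big abc by metis
    have PM: "P d \<subseteq> {..<M}" for d using Suc.prems(1) by (auto simp: P_def)
    have PP: "P d \<inter> P d' = {}" if "d \<noteq> d'" for d d' using that by (auto simp: P_def)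
    have "\<exists>x\<in>X. \<exists>y\<in>Y. \<exists>z\<in>Z. \<phi> {x,y} = c \<and> \<phi> {x,z} = b \<and> \<phi> {y,z} = a"
    proof (rule \<phi>)
      show "X \<subseteq> {..<M}" "Y \<subseteq> {..<M}" "Z \<subseteq> {..<M}" using X Y Z PM by blast+
      show "X \<inter> Y = {}" "X \<inter> Z = {}" "Y \<inter> Z = {}" using X Y Z PP abc by blast+
      show "a < r" "b < r" "c < r" using abc by (auto simp: Big_def)
    qed (use X Y Z in auto)
    then obtain x y z where xyz: "x \<in> P a" "y \<in> P b" "z \<in> P c"
      and col: "\<phi> {x,y} = c" "\<phi> {x,z} = b" "\<phi> {y,z} = a" using X Y Z by blast
    have "level_edge r \<phi> j {x,y,z}"
    proof (rule level_edgeI[where q = q])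
      show "x div r ^ Suc j = q" "y div r ^ Suc j = q" "z div r ^ Suc j = q"
        by (rule Suc.prems(3); use xyz in \<open>simp add: P_def\<close>)+
      show "x div r ^ j \<noteq> y div r ^ j" "x div r ^ j \<noteq> z div r ^ j" "y div r ^ j \<noteq> z div r ^ j"
        using xyz abc by (auto simp: P_def)
    qed (use xyz col in \<open>auto simp: P_def\<close>)
    moreover have "x \<noteq> y" "x \<noteq> z" "y \<noteq> z" using xyz abc by (auto simp: P_def)
    then have "card {x,y,z} = 3" by simp
    moreover have "{x,y,z} \<subseteq> S" using xyz by (auto simp: P_def)
    ultimately show False using Suc.prems(2) by blast
  qed
  define B where "B = 2 ^ j * (1 + r * s) - r * s"
  have B: "card (P c) \<le> B" for c using bound[of c] by (simp add: B_def)
  have "S = (\<Union>c<r. P c)" using r by (auto simp: P_def)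
  then have "card S \<le> (\<Sum>c<r. card (P c))" using card_UN_le[of "{..<r}" P] by simp
  \<comment> \<open>Every child is charged \<open>s\<close>, which covers the small ones; the at
    most two large ones are charged \<open>B\<close> in addition.\<close>
  also have "\<dots> \<le> (\<Sum>c<r. (if c \<in> Big then B else 0) + s)"
    by (intro sum_mono) (use B in \<open>auto simp: Big_def intro: trans_le_add1\<close>)
  also have "\<dots> = card ({..<r} \<inter> Big) * B + r * s"
    by (simp add: sum.distrib sum.If_cases Int_def)
  also have "\<dots> \<le> 2 * B + r * s"
    using Big card_mono[OF finB, of "{..<r} \<inter> Big"] by (intro add_mono mult_right_mono) auto
  finally have "card S \<le> 2 * B + r * s" .
  \<comment> \<open>\<open>bound\<close> also shows that the subtraction in \<open>B\<close> does
    not truncate.\<close>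
  moreover have "B + r * s = 2 ^ j * (1 + r * s)" using bound[of 0] by (simp add: B_def)
  ultimately show ?case by (simp add: algebra_simps)
qed

section \<open>From colourings to the Ramsey number\<close>

text \<open>Ramsey's theorem provides an admissible \<open>N\<close>, without which
  \<open>LEAST\<close> would be unspecified. Each \<open>N \<le> M\<close> is then excluded
  directly, which is why \<open>avoid\<close> asks for a colouring for every such
  \<open>N\<close>.\<close>

lemma ramsey_number_greater:
  fixes H :: "'a hypergraph"
  assumes H: "three_graph H"
    and avoid: "\<And>N. N \<le> M \<Longrightarrow> \<exists>\<chi>. \<not> contains_copy (colour_class (complete3 N) \<chi> Red) H \<and>
                   \<not> contains_copy (colour_class (complete3 N) \<chi> Blue) (complete3 n)"
  shows "ramsey_number H (complete3 n) > M"
proof -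
  define P where "P N \<longleftrightarrow> (\<forall>\<chi>. contains_copy (colour_class (complete3 N) \<chi> Red) H \<or>
                   contains_copy (colour_class (complete3 N) \<chi> Blue) (complete3 n))" for N
  \<comment> \<open>Red is colour 0 with target size \<open>card (verts H)\<close>: a red complete
    3-graph on that many vertices contains a copy of \<open>H\<close>.\<close>
  obtain N where N: "partn_lst {..<N::nat} [card (verts H), n] 3" using ramsey_full by blast
  have "P N"
    unfolding P_def
  proof
    fix \<chi> :: "nat set \<Rightarrow> colour"
    have "(\<lambda>e. if \<chi> e = Red then 0 else 1) \<in> nsets {..<N} 3 \<rightarrow> {..<length [card (verts H), n]}" by auto
    with N obtain i W where i: "i < length [card (verts H), n]" "W \<in> nsets {..<N} ([card (verts H), n] ! i)"
      and mono': "(\<lambda>e. if \<chi> e = Red then 0 else 1) ` nsets W 3 \<subseteq> {i}"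
      unfolding partn_lst_def monochromatic_def by blast
    have mono: "(if \<chi> e = Red then 0 else 1) = i" if "e \<in> nsets W 3" for e
    proof -
      have "(if \<chi> e = Red then 0 else 1) \<in> (\<lambda>e. if \<chi> e = Red then 0 else 1 :: nat) ` nsets W 3"
        using that by (rule imageI)
      then show ?thesis using mono' by blast
    qed
    have W: "W \<subseteq> {..<N}" "finite W" "card W = [card (verts H), n] ! i" using i by (auto simp: nsets_def)
    have copy: "contains_copy (colour_class (complete3 N) \<chi> k) G"
      if G: "three_graph G" "card (verts G) = card W" and k: "\<And>e. e \<in> nsets W 3 \<Longrightarrow> \<chi> e = k"
      for G :: "'c hypergraph" and k
    proof -
      have "finite (verts G)" using G by (simp add: three_graph_def)
      then obtain f where f: "bij_betw f (verts G) W" using finite_same_card_bij W(2) G(2) by blast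
      have "f ` e \<in> nsets W 3" if "e \<in> edges G" for e
        using that G(1) f unfolding three_graph_def nsets_def bij_betw_def
        by (auto simp: card_image[OF inj_on_subset[of f "verts G"]])
      then show ?thesis
        using f W(1) k unfolding contains_copy_def colour_class_def complete3_def
        by (intro exI[of _ f]) (auto simp: bij_betw_def nsets_def)
    qed
    have "three_graph (complete3 n)" "card (verts (complete3 n)) = n"
      by (simp_all add: three_graph_def complete3_def)
    moreover have "\<chi> e \<noteq> Red \<Longrightarrow> \<chi> e = Blue" for e by (cases "\<chi> e") auto
    moreover have "i = 0 \<or> i = 1" using i by auto
    ultimately show "contains_copy (colour_class (complete3 N) \<chi> Red) H \<or>
                   contains_copy (colour_class (complete3 N) \<chi> Blue) (complete3 n)"
      using copy H W(3) mono
      by (metis nth_Cons_0 nth_Cons_Suc One_nat_def zero_neq_one)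
  qed
  then have "P (LEAST N. P N)" by (rule LeastI)
  moreover have "\<not> P N" if "N \<le> M" for N using avoid[OF that] by (auto simp: P_def)
  ultimately have "M < (LEAST N. P N)" by (meson not_le)
  then show ?thesis by (simp add: ramsey_number_def P_def)
qed

section \<open>Random choices for the pairs\<close>

text \<open>Independence in counting form: for a uniformly random \<open>f\<close> the events that
  \<open>f\<close> agrees with \<open>v a\<close> on \<open>D a\<close> concern disjoint sets of
  arguments and have probability \<open>1 / card R ^ d\<close> each, so none occurs with probability
  \<open>(1 - 1 / card R ^ d) ^ card Q\<close>. Clearing denominators gives the identity. In the
  induction \<open>f\<close> splits into its restrictions to \<open>D a\<close> and
  \<open>P - D a\<close>.\<close>

lemma card_PiE_avoiding_patterns:
  fixes D :: "'i \<Rightarrow> 'p set" and v :: "'i \<Rightarrow> 'p \<Rightarrow> 'b"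
  assumes "finite Q" "finite P" "finite R" "disjoint_family_on D Q"
    and "\<And>a. a \<in> Q \<Longrightarrow> D a \<subseteq> P \<and> card (D a) = d \<and> v a ` D a \<subseteq> R"
  shows "card {f \<in> P \<rightarrow>\<^sub>E R. \<forall>a\<in>Q. \<exists>p\<in>D a. f p \<noteq> v a p} * (card R ^ d) ^ card Q
       = (card R ^ d - 1) ^ card Q * card R ^ card P"
  using assms
proof (induction Q arbitrary: P rule: finite_induct)
  case empty
  then show ?case by (simp add: card_PiE)
next
  case (insert a Q P)
  define F where "F = {f \<in> P \<rightarrow>\<^sub>E R. \<forall>b\<in>insert a Q. \<exists>p\<in>D b. f p \<noteq> v b p}"
  define F' where "F' = {f \<in> (P - D a) \<rightarrow>\<^sub>E R. \<forall>b\<in>Q. \<exists>p\<in>D b. f p \<noteq> v b p}"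
  define G where "G = {f \<in> D a \<rightarrow>\<^sub>E R. \<exists>p\<in>D a. f p \<noteq> v a p}"
  have Da: "D a \<subseteq> P" "card (D a) = d" "v a ` D a \<subseteq> R" using insert.prems by auto
  have finD: "finite (D a)" using finite_subset[OF Da(1) insert.prems(1)] .
  have dj: "D b \<inter> D a = {}" "D b \<subseteq> P - D a" if "b \<in> Q" for b
  proof -
    show "D b \<inter> D a = {}"
      using insert.prems(3) insert.hyps(2) that by (auto simp: disjoint_family_on_def)
    then show "D b \<subseteq> P - D a" using insert.prems(4)[of b] that by auto
  qed
  have IH: "card F' * (card R ^ d) ^ card Q = (card R ^ d - 1) ^ card Q * card R ^ card (P - D a)"
    unfolding F'_def
  proof (rule insert.IH)
    show "disjoint_family_on D Q" using insert.prems(3) by (auto simp: disjoint_family_on_def)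
  qed (use insert.prems dj in auto)
  have "G = (D a \<rightarrow>\<^sub>E R) - {restrict (v a) (D a)}"
    unfolding G_def by (auto simp: PiE_def extensional_def fun_eq_iff)
  moreover have "restrict (v a) (D a) \<in> D a \<rightarrow>\<^sub>E R" using Da by auto
  ultimately have cardG: "card G = card R ^ d - 1"
    using finD Da by (simp add: card_PiE)
  have "bij_betw (\<lambda>f. (restrict f (D a), restrict f (P - D a))) F (G \<times> F')"
  proof (rule bij_betwI[where g = "\<lambda>(g, h) p. if p \<in> D a then g p else h p"])
    show "(\<lambda>f. (restrict f (D a), restrict f (P - D a))) \<in> F \<rightarrow> G \<times> F'"
    proof
      fix f assume f: "f \<in> F"
      then have "f ` P \<subseteq> R" by (auto simp: F_def PiE_def)
      then have "restrict f (D a) \<in> G" "restrict f (P - D a) \<in> (P - D a) \<rightarrow>\<^sub>E R"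
        using f Da by (auto simp: F_def G_def)
      moreover have "\<exists>p\<in>D b. restrict f (P - D a) p \<noteq> v b p" if bQ: "b \<in> Q" for b
      proof -
        obtain p where "p \<in> D b" "f p \<noteq> v b p" using f bQ by (auto simp: F_def)
        with dj(2)[OF bQ] show ?thesis by (intro bexI[of _ p]) auto
      qed
      ultimately show "(restrict f (D a), restrict f (P - D a)) \<in> G \<times> F'" by (auto simp: F'_def)
    qed
    show "(\<lambda>(g, h) p. if p \<in> D a then g p else h p) \<in> G \<times> F' \<rightarrow> F"
    proof clarify
      fix g h assume g: "g \<in> G" and h: "h \<in> F'"
      let ?f = "\<lambda>p. if p \<in> D a then g p else h p"
      have "?f \<in> P \<rightarrow>\<^sub>E R"
        using g h Da by (auto simp: G_def F'_def PiE_def extensional_def Pi_def)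
      moreover have "\<exists>p\<in>D a. ?f p \<noteq> v a p" using g by (auto simp: G_def)
      moreover have "\<exists>p\<in>D b. ?f p \<noteq> v b p" if bQ: "b \<in> Q" for b
      proof -
        obtain p where "p \<in> D b" "h p \<noteq> v b p" using h bQ by (auto simp: F'_def)
        with dj(1)[OF bQ] show ?thesis by (intro bexI[of _ p]) auto
      qed
      ultimately show "?f \<in> F" by (auto simp: F_def)
    qed
    fix f assume "f \<in> F"
    then show "(case (restrict f (D a), restrict f (P - D a)) of (g, h) \<Rightarrow> \<lambda>p. if p \<in> D a then g p else h p) = f"
      by (auto simp: F_def PiE_def extensional_def fun_eq_iff)
  next
    fix gh assume "gh \<in> G \<times> F'"
    then show "(restrict (case gh of (g, h) \<Rightarrow> \<lambda>p. if p \<in> D a then g p else h p) (D a),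
               restrict (case gh of (g, h) \<Rightarrow> \<lambda>p. if p \<in> D a then g p else h p) (P - D a)) = gh"
      by (auto simp: G_def F'_def PiE_def extensional_def fun_eq_iff split: prod.splits)
  qed
  then have cardF: "card F = card G * card F'"
    by (simp add: bij_betw_same_card card_cartesian_product)
  have "card R ^ card P = card R ^ d * card R ^ card (P - D a)"
    using Da finD insert.prems(1) card_mono[of P "D a"] by (simp add: card_Diff_subset flip: power_add)
  then have "card F * (card R ^ d) ^ card (insert a Q) = (card R ^ d - 1) ^ card (insert a Q) * card R ^ card P"
    using IH cardF cardG insert.hyps by (simp add: ac_simps)
  then show ?case by (simp add: F_def)
qed

lemma add_mod_left_cancel:
  fixes i k k' s :: nat
  assumes "(i + k) mod s = (i + k') mod s" "i < s" "k < s" "k' < s"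
  shows "k = k'"
proof -
  have mod: "(i + c) mod s = (if i + c < s then i + c else i + c - s)" if "c < s" for c
    using assms(2) that by (simp add: le_mod_geq)
  have "(if i + k < s then i + k else i + k - s) = (if i + k' < s then i + k' else i + k' - s)"
    using assms(1) mod[OF assms(3)] mod[OF assms(4)] by simp
  then show ?thesis using assms(2-4) by (cases "i + k < s"; cases "i + k' < s") (simp_all; linarith)+
qed

text \<open>In a Latin square the triples \<open>(i, k, (i + k) mod s)\<close> pairwise share at most one entry. So the
  \<open>s\<^sup>2\<close> triangles \<open>x i, y k, z ((i + k) mod s)\<close> have disjoint sets of pairs, and a random \<open>\<phi>\<close> treats
  them independently.\<close>

lemma exists_pair_colouring:
  fixes V :: "'a set" and r s :: nat
  assumes V: "finite V" and r: "r > 0"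
    and small: "card V ^ (3 * s) * r ^ 3 * (r ^ 3 - 1) ^ (s\<^sup>2) < (r ^ 3) ^ (s\<^sup>2)"
  obtains \<phi> :: "'a set \<Rightarrow> nat" where
    "\<And>X Y Z a b c. \<lbrakk>X \<subseteq> V; Y \<subseteq> V; Z \<subseteq> V; card X = s; card Y = s; card Z = s;
       X \<inter> Y = {}; X \<inter> Z = {}; Y \<inter> Z = {}; a < r; b < r; c < r\<rbrakk> \<Longrightarrow>
       \<exists>x\<in>X. \<exists>y\<in>Y. \<exists>z\<in>Z. \<phi> {x,y} = c \<and> \<phi> {x,z} = b \<and> \<phi> {y,z} = a"
proof -
  define P where "P = nsets V 2"
  have finP: "finite P" using V by (simp add: P_def finite_imp_finite_nsets)
  define \<Phi> where "\<Phi> = P \<rightarrow>\<^sub>E {..<r}"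
  have fin\<Phi>: "finite \<Phi>" using finP by (simp add: \<Phi>_def finite_PiE)
  have card\<Phi>: "card \<Phi> = r ^ card P" using finP by (simp add: \<Phi>_def card_PiE)
  \<comment> \<open>Sets of size \<open>s\<close> are represented by their enumerations.
    Overcounting is harmless in a union bound and makes its index set \<open>T\<close> a
    product.\<close>
  define W where "W = {..<s} \<rightarrow>\<^sub>E V"
  have finW: "finite W" using V by (simp add: W_def finite_PiE)
  have cardW: "card W = card V ^ s" by (simp add: W_def card_PiE)
  define T where "T = W \<times> W \<times> W \<times> {..<r} \<times> {..<r} \<times> {..<r}"
  have finT: "finite T" using finW by (simp add: T_def)
  have cardT: "card T = card V ^ (3 * s) * r ^ 3"
    by (simp add: T_def card_cartesian_product cardW power3_eq_cube power_mult ac_simps flip: power_add)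
  define Q where "Q = {..<s} \<times> {..<s}"
  have finQ: "finite Q" and cardQ: "card Q = s\<^sup>2" by (simp_all add: Q_def card_cartesian_product power2_eq_square)
  define sep where "sep x y z \<longleftrightarrow> inj_on x {..<s} \<and> inj_on y {..<s} \<and> inj_on z {..<s} \<and>
      x ` {..<s} \<inter> y ` {..<s} = {} \<and> x ` {..<s} \<inter> z ` {..<s} = {} \<and> y ` {..<s} \<inter> z ` {..<s} = {}"
    for x y z :: "nat \<Rightarrow> 'a"
  \<comment> \<open>Only the \<open>s ^ 2\<close> triangles of the Latin square are examined, and an
    index that fails \<open>sep\<close> counts as good.\<close>
  define good where "good \<phi> t \<longleftrightarrow> (case t of (x, y, z, a, b, c) \<Rightarrow> sep x y z \<longrightarrow>
      (\<exists>i<s. \<exists>k<s. \<phi> {x i, y k} = c \<and> \<phi> {x i, z ((i + k) mod s)} = b \<and> \<phi> {y k, z ((i + k) mod s)} = a))"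
    for \<phi> :: "'a set \<Rightarrow> nat" and t
  have bad: "card {\<phi> \<in> \<Phi>. \<not> good \<phi> t} * (r ^ 3) ^ (s\<^sup>2) \<le> (r ^ 3 - 1) ^ (s\<^sup>2) * card \<Phi>"
    if "t \<in> T" for t
  proof -
    obtain x y z a b c where t: "t = (x, y, z, a, b, c)" by (cases t) auto
    have abc: "a < r" "b < r" "c < r" and W: "x \<in> W" "y \<in> W" "z \<in> W" using that by (auto simp: T_def t)
    show ?thesis
    proof (cases "sep x y z")
      case False
      then show ?thesis by (simp add: good_def t)
    next
      case True
      define m where "m i k = (i + k) mod s" for i k
      have m: "m i k < s" if "i < s" for i k using that by (auto simp: m_def)
      have minj: "k = k'" if "m i k = m i k'" "i < s" "k < s" "k' < s" for i k k'
        using that unfolding m_def by (rule add_mod_left_cancel)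
      have minj': "i = i'" if "m i k = m i' k" "i < s" "i' < s" "k < s" for i i' k
        using that unfolding m_def add.commute[of _ k] by (intro add_mod_left_cancel[of k i s i'])
      have eqs: "x i = x i' \<longleftrightarrow> i = i'" "y i = y i' \<longleftrightarrow> i = i'" "z i = z i' \<longleftrightarrow> i = i'"
        and nes: "x i \<noteq> y i'" "x i \<noteq> z i'" "y i \<noteq> z i'" "y i \<noteq> x i'" "z i \<noteq> x i'" "z i \<noteq> y i'"
        if "i < s" "i' < s" for i i'
        using True that by (auto simp: sep_def inj_on_def)
      have inV: "x i \<in> V" "y i \<in> V" "z i \<in> V" if "i < s" for i using W that by (auto simp: W_def)
      \<comment> \<open>\<open>D (i, k)\<close> holds the three pairs of one triangle and
        \<open>v (i, k)\<close> the values wanted on them; the final \<open>else\<close> serves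
        \<open>{y k, z (m i k)}\<close>.\<close>
      define D where "D = (\<lambda>(i, k). {{x i, y k}, {x i, z (m i k)}, {y k, z (m i k)}})"
      define v where "v = (\<lambda>(i, k) p. if p = {x i, y k} then c else if p = {x i, z (m i k)} then b else a)"
      have ne: "{x i, y k} \<noteq> {x i, z (m i k)}" "{x i, y k} \<noteq> {y k, z (m i k)}" "{x i, z (m i k)} \<noteq> {y k, z (m i k)}"
        if "i < s" "k < s" for i k
        using that m[of i k] nes by (auto simp: doubleton_eq_iff)
      have eq: "card {f \<in> P \<rightarrow>\<^sub>E {..<r}. \<forall>q\<in>Q. \<exists>p\<in>D q. f p \<noteq> v q p} * (card {..<r} ^ 3) ^ card Q
          = (card {..<r} ^ 3 - 1) ^ card Q * card {..<r} ^ card P"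
      proof (rule card_PiE_avoiding_patterns[OF finQ finP])
        \<comment> \<open>Any two of \<open>i\<close>, \<open>k\<close> and \<open>m i k\<close>
          determine the third, so a common pair would force
          \<open>(i, k) = (i', k')\<close>.\<close>
        show "disjoint_family_on D Q"
          unfolding disjoint_family_on_def
        proof (intro ballI impI)
          fix q q' assume qq: "q \<in> Q" "q' \<in> Q" "q \<noteq> q'"
          obtain i k i' k' where q: "q = (i, k)" "q' = (i', k')" by (meson surj_pair)
          have neq: "(i, k) \<noteq> (i', k')" and lt: "i < s" "k < s" "i' < s" "k' < s"
            using qq by (auto simp: q Q_def)
          note mm = m[OF lt(1), of k] m[OF lt(3), of k']
          have "{x i, y k} \<notin> D (i', k')" using neq lt mm by (auto simp: D_def doubleton_eq_iff eqs nes)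
          moreover have "{x i, z (m i k)} \<notin> D (i', k')"
            using neq lt mm minj by (auto simp: D_def doubleton_eq_iff eqs nes)
          moreover have "{y k, z (m i k)} \<notin> D (i', k')"
            using neq lt mm minj' by (auto simp: D_def doubleton_eq_iff eqs nes)
          moreover have "D q = {{x i, y k}, {x i, z (m i k)}, {y k, z (m i k)}}" by (simp add: q D_def)
          ultimately show "D q \<inter> D q' = {}" by (auto simp: q(2))
        qed
        fix q assume "q \<in> Q"
        then obtain i k where q: "q = (i, k)" "i < s" "k < s" by (auto simp: Q_def)
        have "D q \<subseteq> P"
          using q m[of i k] inV nes by (auto simp: D_def P_def nsets_def)
        moreover have "card (D q) = 3" using ne[OF q(2,3)] by (simp add: q(1) D_def)
        moreover have "v q ` D q \<subseteq> {..<r}" using abc by (auto simp: q(1) v_def)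
        ultimately show "D q \<subseteq> P \<and> card (D q) = 3 \<and> v q ` D q \<subseteq> {..<r}" by blast
      qed simp
      have "{\<phi> \<in> \<Phi>. \<not> good \<phi> t} \<subseteq> {f \<in> P \<rightarrow>\<^sub>E {..<r}. \<forall>q\<in>Q. \<exists>p\<in>D q. f p \<noteq> v q p}"
      proof
        fix \<phi> assume "\<phi> \<in> {\<phi> \<in> \<Phi>. \<not> good \<phi> t}"
        then have \<phi>: "\<phi> \<in> \<Phi>" "\<not> good \<phi> t" by auto
        have "\<exists>p\<in>D q. \<phi> p \<noteq> v q p" if "q \<in> Q" for q
        proof -
          obtain i k where q: "q = (i, k)" and ik: "i < s" "k < s" using \<open>q \<in> Q\<close> by (auto simp: Q_def)
          have "\<not> (\<phi> {x i, y k} = c \<and> \<phi> {x i, z (m i k)} = b \<and> \<phi> {y k, z (m i k)} = a)"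
            using \<phi>(2) True ik by (auto simp: good_def t m_def)
          then show ?thesis using ne[OF ik] by (auto simp: q D_def v_def)
        qed
        with \<phi>(1) show "\<phi> \<in> {f \<in> P \<rightarrow>\<^sub>E {..<r}. \<forall>q\<in>Q. \<exists>p\<in>D q. f p \<noteq> v q p}" by (simp add: \<Phi>_def)
      qed
      then have "card {\<phi> \<in> \<Phi>. \<not> good \<phi> t} \<le> card {f \<in> P \<rightarrow>\<^sub>E {..<r}. \<forall>q\<in>Q. \<exists>p\<in>D q. f p \<noteq> v q p}"
        using fin\<Phi> by (intro card_mono) (auto simp: \<Phi>_def)
      from mult_le_mono1[OF this, of "(r ^ 3) ^ (s\<^sup>2)"] show ?thesis
        using eq unfolding card\<Phi> cardQ card_lessThan by (simp only:)
    qed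
  qed
  \<comment> \<open>Union bound: otherwise the bad sets would cover \<open>\<Phi>\<close>, against
    \<open>small\<close>.\<close>
  have "\<exists>\<phi>\<in>\<Phi>. \<forall>t\<in>T. good \<phi> t"
  proof (rule ccontr)
    assume "\<not> ?thesis"
    then have "\<Phi> \<subseteq> (\<Union>t\<in>T. {\<phi> \<in> \<Phi>. \<not> good \<phi> t})" by blast
    then have "card \<Phi> \<le> card (\<Union>t\<in>T. {\<phi> \<in> \<Phi>. \<not> good \<phi> t})"
      using finT fin\<Phi> by (intro card_mono) auto
    also have "\<dots> \<le> (\<Sum>t\<in>T. card {\<phi> \<in> \<Phi>. \<not> good \<phi> t})" using finT by (rule card_UN_le)
    finally have le: "card \<Phi> \<le> (\<Sum>t\<in>T. card {\<phi> \<in> \<Phi>. \<not> good \<phi> t})" .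
    have "card \<Phi> * (r ^ 3) ^ (s\<^sup>2) \<le> (\<Sum>t\<in>T. card {\<phi> \<in> \<Phi>. \<not> good \<phi> t} * (r ^ 3) ^ (s\<^sup>2))"
      using mult_le_mono1[OF le] by (simp only: sum_distrib_right)
    also have "\<dots> \<le> (\<Sum>t\<in>T. (r ^ 3 - 1) ^ (s\<^sup>2) * card \<Phi>)" using bad by (rule sum_mono)
    also have "\<dots> = card \<Phi> * (card V ^ (3 * s) * r ^ 3 * (r ^ 3 - 1) ^ (s\<^sup>2))"
      by (simp add: cardT ac_simps)
    also have "\<dots> < card \<Phi> * (r ^ 3) ^ (s\<^sup>2)" using small r card\<Phi> by (intro mult_strict_left_mono) auto
    finally show False by simp
  qed
  then obtain \<phi> where \<phi>: "\<And>t. t \<in> T \<Longrightarrow> good \<phi> t" by blast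
  show thesis
  proof (rule that[of \<phi>])
    fix X Y Z a b c
    assume sub: "X \<subseteq> V" "Y \<subseteq> V" "Z \<subseteq> V" and card: "card X = s" "card Y = s" "card Z = s"
      and dj: "X \<inter> Y = {}" "X \<inter> Z = {}" "Y \<inter> Z = {}" and abc: "a < r" "b < r" "c < r"
    have enum: "\<exists>x. x \<in> W \<and> inj_on x {..<s} \<and> x ` {..<s} = X" if X: "X \<subseteq> V" "card X = s" for X
    proof -
      obtain h where h: "bij_betw h {..<s} X"
        using ex_bij_betw_nat_finite[OF finite_subset[OF X(1) V]] X(2) by (auto simp: atLeast0LessThan)
      then have "restrict h {..<s} \<in> W" "inj_on (restrict h {..<s}) {..<s}" "restrict h {..<s} ` {..<s} = X"
        using X(1) by (auto simp: W_def bij_betw_def)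
      then show ?thesis by blast
    qed
    obtain x y z where xyz: "x \<in> W" "inj_on x {..<s}" "x ` {..<s} = X" "y \<in> W" "inj_on y {..<s}" "y ` {..<s} = Y"
      "z \<in> W" "inj_on z {..<s}" "z ` {..<s} = Z"
      using enum sub card by metis
    then have "(x, y, z, a, b, c) \<in> T" "sep x y z" using abc dj by (auto simp: T_def sep_def)
    with \<phi>[OF this(1)] obtain i k where ik: "i < s" "k < s"
      "\<phi> {x i, y k} = c \<and> \<phi> {x i, z ((i + k) mod s)} = b \<and> \<phi> {y k, z ((i + k) mod s)} = a"
      by (auto simp: good_def)
    moreover have "(i + k) mod s < s" using ik by simp
    ultimately show "\<exists>x\<in>X. \<exists>y\<in>Y. \<exists>z\<in>Z. \<phi> {x,y} = c \<and> \<phi> {x,z} = b \<and> \<phi> {y,z} = a"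
      using xyz by blast
  qed
qed

section \<open>Choice of parameters and the final bound\<close>

lemma pow4_gt: "k \<ge> 4 \<Longrightarrow> 3 * k\<^sup>2 + 3 * k < (4::nat) ^ k"
proof (induction k rule: dec_induct)
  case (step k)
  have "4 * k \<le> k\<^sup>2" using step by (simp add: power2_eq_square)
  then show ?case using step by (simp add: power2_eq_square algebra_simps)
qed simp

text \<open>The exponent \<open>5 * k\<close> makes \<open>s ^ 2 / r ^ 3\<close> equal to
  \<open>s * 4 ^ k\<close>, so the failure probability \<open>(1 - 1 / r ^ 3) ^ (s ^ 2)\<close> is
  at most \<open>exp (- s * 4 ^ k)\<close>. The number of indices is \<open>2 ^ E\<close>, where
  \<open>E < s * 4 ^ k\<close> by \<open>pow4_gt\<close>.\<close>

lemma union_bound_parameters: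
  fixes k :: nat
  assumes k: "k \<ge> 4"
  defines "r \<equiv> (2::nat) ^ k" and "s \<equiv> (2::nat) ^ (5 * k)"
  shows "(r ^ k) ^ (3 * s) * r ^ 3 * (r ^ 3 - 1) ^ (s\<^sup>2) < (r ^ 3) ^ (s\<^sup>2)"
proof -
  have r: "r \<ge> 1" by (simp add: r_def)
  have s: "s \<ge> 1" by (simp add: s_def)
  define E where "E = 3 * k\<^sup>2 * s + 3 * k"
  have pow: "(r ^ k) ^ (3 * s) * r ^ 3 = 2 ^ E"
    by (simp add: r_def E_def power2_eq_square ac_simps flip: power_mult power_add)
  have q: "s\<^sup>2 = s * 4 ^ k * r ^ 3"
  proof -
    have "(4::nat) ^ k = 2 ^ (2 * k)" by (simp add: power_mult)
    then show ?thesis by (simp add: r_def s_def flip: power_mult power_add)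
  qed
  have "E \<le> s * (3 * k\<^sup>2 + 3 * k)" using s by (simp add: E_def algebra_simps)
  also have "\<dots> < s * 4 ^ k" using pow4_gt[OF k] s by (intro mult_strict_left_mono) auto
  finally have E: "E < s * 4 ^ k" .
  have r3: "real (r ^ 3) > 0" "real (r ^ 3) \<ge> 1" using r by auto
  have "real (2 ^ E) \<le> exp 1 ^ E" using exp_ge_add_one_self[of 1] by (simp add: power_mono)
  also have "\<dots> = exp (real E)" by (simp flip: exp_of_nat_mult)
  also have "\<dots> < exp (real (s * 4 ^ k))" using E by (simp del: of_nat_mult of_nat_power)
  finally have 1: "real (2 ^ E) < exp (real (s * 4 ^ k))" .
  have "(1 - 1 / real (r ^ 3)) ^ (s\<^sup>2) \<le> exp (- (1 / real (r ^ 3))) ^ (s\<^sup>2)"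
    using exp_ge_add_one_self[of "- (1 / real (r ^ 3))"] r3 by (intro power_mono) auto
  also have "\<dots> = exp (- (real (s\<^sup>2) / real (r ^ 3)))" by (simp flip: exp_of_nat_mult)
  also have "real (s\<^sup>2) / real (r ^ 3) = real (s * 4 ^ k)"
    using r3(1) unfolding q by (simp del: of_nat_power)
  finally have 2: "(1 - 1 / real (r ^ 3)) ^ (s\<^sup>2) \<le> exp (- real (s * 4 ^ k))" .
  have "real (2 ^ E * (r ^ 3 - 1) ^ (s\<^sup>2)) = real (2 ^ E) * ((1 - 1 / real (r ^ 3)) ^ (s\<^sup>2) * real (r ^ 3) ^ (s\<^sup>2))"
  proof -
    have "real (r ^ 3 - 1) = (1 - 1 / real (r ^ 3)) * real (r ^ 3)"
      using r3 r by (simp add: of_nat_diff field_simps)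
    then have "real ((r ^ 3 - 1) ^ (s\<^sup>2)) = (1 - 1 / real (r ^ 3)) ^ (s\<^sup>2) * real (r ^ 3) ^ (s\<^sup>2)"
      by (simp only: of_nat_power[of "r ^ 3 - 1"] power_mult_distrib)
    then show ?thesis by (simp only: of_nat_mult)
  qed
  also have "\<dots> \<le> real (2 ^ E) * (exp (- real (s * 4 ^ k)) * real (r ^ 3) ^ (s\<^sup>2))"
    using 2 by (intro mult_left_mono mult_right_mono) auto
  also have "\<dots> < exp (real (s * 4 ^ k)) * (exp (- real (s * 4 ^ k)) * real (r ^ 3) ^ (s\<^sup>2))"
    using 1 r3 by (intro mult_strict_right_mono) auto
  also have "\<dots> = real ((r ^ 3) ^ (s\<^sup>2))" by (simp add: exp_minus)
  finally show ?thesis unfolding pow by (simp only: of_nat_less_iff)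
qed

lemma ramsey_number_greater_power:
  fixes H :: "'a hypergraph" and k n :: nat
  assumes H: "three_graph H" and tc: "card (tight_components H) \<le> 2"
    and it: "\<not> iterated_tripartite H" and k: "k \<ge> 4" and n: "2 ^ (8 * k) \<le> n"
  shows "ramsey_number H (complete3 n) > 2 ^ (k\<^sup>2)"
proof -
  define r where "r = (2::nat) ^ k"
  define s where "s = (2::nat) ^ (5 * k)"
  have r: "r > 0" by (simp add: r_def)
  have M: "2 ^ (k\<^sup>2) = r ^ k" by (simp add: r_def power2_eq_square flip: power_mult)
  have "card {..<r ^ k} ^ (3 * s) * r ^ 3 * (r ^ 3 - 1) ^ (s\<^sup>2) < (r ^ 3) ^ (s\<^sup>2)"
    using union_bound_parameters[OF k] by (simp add: r_def s_def)
  then obtain \<phi> :: "nat set \<Rightarrow> nat" where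
    \<phi>: "\<And>X Y Z a b c. \<lbrakk>X \<subseteq> {..<r ^ k}; Y \<subseteq> {..<r ^ k}; Z \<subseteq> {..<r ^ k}; card X = s; card Y = s; card Z = s;
       X \<inter> Y = {}; X \<inter> Z = {}; Y \<inter> Z = {}; a < r; b < r; c < r\<rbrakk> \<Longrightarrow>
       \<exists>x\<in>X. \<exists>y\<in>Y. \<exists>z\<in>Z. \<phi> {x,y} = c \<and> \<phi> {x,z} = b \<and> \<phi> {y,z} = a"
    using exists_pair_colouring[OF finite_lessThan r] by metis
  \<comment> \<open>One colouring of all sets of naturals serves every \<open>N\<close>; the
    restriction \<open>N \<le> r ^ k\<close> enters only in the blue case.\<close>
  define \<chi> where "\<chi> e = (if \<exists>j. level_edge r \<phi> j e then Red else Blue)" for e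
  have "\<not> contains_copy (colour_class (complete3 N) \<chi> Red) H" for N
  proof
    assume "contains_copy (colour_class (complete3 N) \<chi> Red) H"
    then obtain f where "inj_on f (verts H)" "\<And>e. e \<in> edges H \<Longrightarrow> \<chi> (f ` e) = Red"
      by (auto simp: contains_copy_def colour_class_def)
    then show False
      using iterated_tripartite_if_embeds[OF H tc, of f r \<phi>] it by (metis \<chi>_def colour.distinct(1))
  qed
  moreover have "\<not> contains_copy (colour_class (complete3 N) \<chi> Blue) (complete3 n)" if N: "N \<le> r ^ k" for N
  proof
    assume "contains_copy (colour_class (complete3 N) \<chi> Blue) (complete3 n)"
    then obtain f where f: "inj_on f {..<n}" "f ` {..<n} \<subseteq> {..<N}"
      and blue: "\<And>e. e \<in> nsets {..<n} 3 \<Longrightarrow> \<chi> (f ` e) = Blue"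
      by (auto simp: contains_copy_def colour_class_def complete3_def)
    define S where "S = f ` {..<n}"
    have SM: "S \<subseteq> {..<r ^ k}" using f(2) N by (auto simp: S_def)
    have "\<not> level_edge r \<phi> j e" if e: "e \<subseteq> S" "card e = 3" for e j
    proof -
      obtain d where d: "d \<subseteq> {..<n}" "e = f ` d" using e(1) unfolding S_def by (meson subset_imageE)
      have "inj_on f d" using f(1) d(1) by (rule inj_on_subset)
      then have "d \<in> nsets {..<n} 3"
        using d e(2) by (auto simp: nsets_def card_image intro: finite_subset)
      then show ?thesis using blue[of d] d(2) by (auto simp: \<chi>_def split: if_splits)
    qed
    then have "card S + r * s \<le> 2 ^ k * (1 + r * s)"
      \<comment> \<open>\<open>q = 0\<close> is the root: \<open>x div r ^ k = 0\<close> for every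
        vertex \<open>x < r ^ k\<close>.\<close>
      using \<phi> SM by (intro card_independent_le[OF r, where q = 0 and \<phi> = \<phi> and M = "r ^ k"]) auto
    moreover have "card S = n" using f(1) by (simp add: S_def card_image)
    moreover have "2 ^ k * (1 + r * s) - r * s < 2 ^ (8 * k)"
    proof -
      have "2 ^ k * (1 + r * s) = 2 ^ k + 2 ^ (7 * k)"
        by (simp add: r_def s_def algebra_simps flip: power_add)
      also have "\<dots> < 2 ^ (7 * k) + 2 ^ (7 * k)" using k by simp
      also have "\<dots> = 2 ^ (7 * k + 1)" by simp
      also have "\<dots> \<le> 2 ^ (8 * k)" using k by (intro power_increasing) auto
      finally show ?thesis by simp
    qed
    ultimately show False using n by linarith
  qed
  ultimately show ?thesis
    unfolding M by (intro ramsey_number_greater[OF H]) blast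
qed

theorem theorem1p3:
  fixes H :: "'a hypergraph"
  assumes "three_graph H"
    and "card (tight_components H) \<le> 2"
    and "\<not> iterated_tripartite H"
  shows "\<exists>(c::real) (n0::nat). c > 0 \<and>
           (\<forall>n\<ge>n0. real (ramsey_number H (complete3 n)) \<ge> 2 powr (c * (log 2 (real n))\<^sup>2))"
proof (intro exI[of _ "1/256"] exI[of _ "2 ^ 32"] conjI allI impI)
  fix n :: nat assume n: "2 ^ 32 \<le> n"
  define L where "L = log 2 (real n)"
  \<comment> \<open>This is the largest \<open>k\<close> with \<open>2 ^ (8 * k) \<le> n\<close>;
    the threshold \<open>2 ^ 32\<close> ensures \<open>k \<ge> 4\<close>.\<close>
  define k where "k = nat \<lfloor>L / 8\<rfloor>"
  have "0 < (2::nat) ^ 32" by simp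
  with n have npos: "real n > 0" by linarith
  have "2 powr 32 \<le> real n" using n by (simp add: powr_numeral)
  then have L: "L \<ge> 32" using npos by (simp add: L_def le_log_iff)
  have k1: "real k \<le> L / 8" "L / 8 < real k + 1" using L by (auto simp: k_def) linarith+
  have "k \<ge> 4" using L k1 by linarith
  moreover have "2 ^ (8 * k) \<le> n"
  proof -
    have "real (2 ^ (8 * k)) = 2 powr (8 * real k)" using powr_realpow[of 2 "8 * k"] by simp
    also have "\<dots> \<le> 2 powr L" using k1 by (intro powr_mono) auto
    also have "\<dots> = real n" using npos by (simp add: L_def)
    finally show ?thesis by (simp only: of_nat_le_iff)
  qed
  ultimately have "2 ^ (k\<^sup>2) < ramsey_number H (complete3 n)"
    using ramsey_number_greater_power[OF assms] by blast
  then have "real (2 ^ (k\<^sup>2)) < real (ramsey_number H (complete3 n))" by (simp only: of_nat_less_iff)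
  moreover have "2 powr (1/256 * L\<^sup>2) \<le> 2 powr (real (k\<^sup>2))"
  proof (rule powr_mono)
    \<comment> \<open>Rounding down loses less than 1, and \<open>L / 8 - 1 \<ge> L / 16\<close>
      once \<open>L \<ge> 16\<close>. Squaring \<open>L / 16\<close> produces the constant
      \<open>1/256\<close>.\<close>
    have "L / 16 \<le> real k" using k1 L by linarith
    then have "(L / 16)\<^sup>2 \<le> (real k)\<^sup>2" using L by (intro power_mono) auto
    then show "1/256 * L\<^sup>2 \<le> real (k\<^sup>2)" by (simp add: power_divide)
  qed simp
  moreover have "2 powr real (k\<^sup>2) = real (2 ^ (k\<^sup>2))" using powr_realpow[of 2 "k\<^sup>2"] by simp
  ultimately show "2 powr (1/256 * (log 2 (real n))\<^sup>2) \<le> real (ramsey_number H (complete3 n))"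
    unfolding L_def by linarith
qed simp

end
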